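(* Let $\mathcal{C}$ be the closure of the class $\{W_{2n+1}: n\ge 1\}$ of odd wheels under taking subgraphs and disjoint unions. Then $\mathcal{C}$ does not have the homomorphism preservation property: there is a first-order sentence preserved by homomorphisms over $\mathcal{C}$ that is not equivalent over $\mathcal{C}$ to any existential-positive sentence.
   Context: Graphs are finite, simple and undirected. For $n\ge 3$, the wheel $W_n$ is a cycle of length $n$ together with an apex vertex adjacent to all cycle vertices. Subgraphs are obtained by deleting vertices and/or edges. A first-order sentence $\phi$ is preserved by homomorphisms over $\mathcal{C}$ if whenever $A,B\in\mathcal{C}$, there is a homomorphism $A\to B$ and $A\models\phi$, then $B\models\phi$. $\mathcal{C}$ has the homomorphism preservation property if every first-order sentence preserved by homomorphisms over $\mathcal{C}$ is equivalent on all graphs in $\mathcal{C}$ to an existential-positive sentence. *)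

theory Defs
  imports "Graph_Theory.Digraph_Component" "Graph_Theory.Digraph_Isomorphism"
begin

section \<open>Graphs\<close>

text \<open>
  A finite simple undirected graph is a \<^const>\<open>pair_graph\<close>: a finite symmetric loopless relation
  on a finite vertex set, an undirected edge being a pair of opposite arcs. Classes of graphs
  are sets of graphs with vertices in \<^typ>\<open>nat\<close>, which covers every finite graph up to isomorphism.
  The graph without vertices is not excluded.
\<close>

definition graph_hom :: "'a pair_pre_digraph \<Rightarrow> 'b pair_pre_digraph \<Rightarrow> ('a \<Rightarrow> 'b) \<Rightarrow> bool" where
  "graph_hom G H f \<longleftrightarrow>
     (\<forall>v \<in> pverts G. f v \<in> pverts H) \<and> (\<forall>(u, v) \<in> parcs G. (f u, f v) \<in> parcs H)"

definition graph_union ::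
  "'a pair_pre_digraph \<Rightarrow> 'a pair_pre_digraph \<Rightarrow> 'a pair_pre_digraph" where
  "graph_union G H = \<lparr>pverts = pverts G \<union> pverts H, parcs = parcs G \<union> parcs H\<rparr>"

text \<open>The rim of the wheel is \<open>{0..<n}\<close> and its apex is \<open>n\<close>. Only meaningful for \<open>n \<ge> 3\<close>.\<close>

definition wheel :: "nat \<Rightarrow> nat pair_pre_digraph" where
  "wheel n = \<lparr>pverts = {0..n},
     parcs = {(i, j). i < n \<and> j < n \<and> (j = Suc i mod n \<or> i = Suc j mod n)}
           \<union> {(i, n) | i. i < n} \<union> {(n, i) | i. i < n}\<rparr>"

text \<open>
  The isomorphism rule makes the class independent of vertex names. Together with the rule for
  vertex-disjoint graphs it gives the disjoint union of any two members, since every finite graph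
  has a copy avoiding a given finite set of vertices. The premise \<^term>\<open>pair_graph H\<close> in the subgraph
  rule says that the two arcs of an edge are deleted together.
\<close>

inductive_set subgraph_union_closure :: "nat pair_pre_digraph set \<Rightarrow> nat pair_pre_digraph set"
  for K :: "nat pair_pre_digraph set" where
  base: "G \<in> K \<Longrightarrow> G \<in> subgraph_union_closure K"
| iso: "G \<in> subgraph_union_closure K \<Longrightarrow> digraph_iso (with_proj G) (with_proj H)
    \<Longrightarrow> H \<in> subgraph_union_closure K"
| subgraph: "G \<in> subgraph_union_closure K \<Longrightarrow> pair_graph H
    \<Longrightarrow> subgraph (with_proj H) (with_proj G) \<Longrightarrow> H \<in> subgraph_union_closure K"
| disjoint_union: "G \<in> subgraph_union_closure K \<Longrightarrow> H \<in> subgraph_union_closure K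
    \<Longrightarrow> pverts G \<inter> pverts H = {} \<Longrightarrow> graph_union G H \<in> subgraph_union_closure K"

definition odd_wheel_class :: "nat pair_pre_digraph set" where
  "odd_wheel_class = subgraph_union_closure {wheel (2 * n + 1) | n. n \<ge> 1}"


section \<open>First-order logic of graphs\<close>

datatype fm =
    Tru
  | Fls
  | Eql nat nat
  | Adj nat nat
  | Neg fm
  | Cnj fm fm
  | Dsj fm fm
  | Exi nat fm
  | Uni nat fm

primrec free_vars :: "fm \<Rightarrow> nat set" where
  "free_vars Tru = {}"
| "free_vars Fls = {}"
| "free_vars (Eql x y) = {x, y}"
| "free_vars (Adj x y) = {x, y}"
| "free_vars (Neg p) = free_vars p"
| "free_vars (Cnj p q) = free_vars p \<union> free_vars q"
| "free_vars (Dsj p q) = free_vars p \<union> free_vars q"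
| "free_vars (Exi x p) = free_vars p - {x}"
| "free_vars (Uni x p) = free_vars p - {x}"

definition sentence :: "fm \<Rightarrow> bool" where
  "sentence p \<longleftrightarrow> free_vars p = {}"

primrec sat :: "'a pair_pre_digraph \<Rightarrow> (nat \<Rightarrow> 'a) \<Rightarrow> fm \<Rightarrow> bool" where
  "sat G s Tru \<longleftrightarrow> True"
| "sat G s Fls \<longleftrightarrow> False"
| "sat G s (Eql x y) \<longleftrightarrow> s x = s y"
| "sat G s (Adj x y) \<longleftrightarrow> (s x, s y) \<in> parcs G"
| "sat G s (Neg p) \<longleftrightarrow> \<not> sat G s p"
| "sat G s (Cnj p q) \<longleftrightarrow> sat G s p \<and> sat G s q"
| "sat G s (Dsj p q) \<longleftrightarrow> sat G s p \<or> sat G s q"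
| "sat G s (Exi x p) \<longleftrightarrow> (\<exists>v \<in> pverts G. sat G (s(x := v)) p)"
| "sat G s (Uni x p) \<longleftrightarrow> (\<forall>v \<in> pverts G. sat G (s(x := v)) p)"

text \<open>
  Assignments may take values outside \<^term>\<open>pverts G\<close>; for sentences the assignment is
  irrelevant (lemma \<open>models_iff_sat\<close> below).
\<close>

definition models :: "'a pair_pre_digraph \<Rightarrow> fm \<Rightarrow> bool" where
  "models G p \<longleftrightarrow> (\<forall>s. sat G s p)"

lemma sat_cong: "(\<And>x. x \<in> free_vars p \<Longrightarrow> s x = t x) \<Longrightarrow> sat G s p \<longleftrightarrow> sat G t p"
proof (induction p arbitrary: s t)
  case (Exi x p)
  have "sat G (s(x := v)) p \<longleftrightarrow> sat G (t(x := v)) p" for v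
    by (rule Exi.IH) (use Exi.prems in auto)
  then show ?case by simp
next
  case (Uni x p)
  have "sat G (s(x := v)) p \<longleftrightarrow> sat G (t(x := v)) p" for v
    by (rule Uni.IH) (use Uni.prems in auto)
  then show ?case by simp
next
  case (Neg p)
  then show ?case by (metis free_vars.simps(5) sat.simps(5))
next
  case (Cnj p q)
  then show ?case by (metis UnCI free_vars.simps(6) sat.simps(6))
next
  case (Dsj p q)
  then show ?case by (metis UnCI free_vars.simps(7) sat.simps(7))
qed simp_all

lemma models_iff_sat: "sentence p \<Longrightarrow> models G p \<longleftrightarrow> sat G s p"
  unfolding models_def sentence_def using sat_cong by (metis empty_iff)

primrec existential_positive :: "fm \<Rightarrow> bool" where
  "existential_positive Tru \<longleftrightarrow> True"
| "existential_positive Fls \<longleftrightarrow> True"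
| "existential_positive (Eql x y) \<longleftrightarrow> True"
| "existential_positive (Adj x y) \<longleftrightarrow> True"
| "existential_positive (Neg p) \<longleftrightarrow> False"
| "existential_positive (Cnj p q) \<longleftrightarrow> existential_positive p \<and> existential_positive q"
| "existential_positive (Dsj p q) \<longleftrightarrow> existential_positive p \<and> existential_positive q"
| "existential_positive (Exi x p) \<longleftrightarrow> existential_positive p"
| "existential_positive (Uni x p) \<longleftrightarrow> False"


section \<open>Homomorphism preservation\<close>

definition preserved_by_homs :: "'a pair_pre_digraph set \<Rightarrow> fm \<Rightarrow> bool" where
  "preserved_by_homs C p \<longleftrightarrow>
     (\<forall>A \<in> C. \<forall>B \<in> C. (\<exists>f. graph_hom A B f) \<longrightarrow> models A p \<longrightarrow> models B p)"

definition equivalent_on :: "'a pair_pre_digraph set \<Rightarrow> fm \<Rightarrow> fm \<Rightarrow> bool" where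
  "equivalent_on C p q \<longleftrightarrow> (\<forall>A \<in> C. models A p \<longleftrightarrow> models A q)"

definition hom_preservation_property :: "'a pair_pre_digraph set \<Rightarrow> bool" where
  "hom_preservation_property C \<longleftrightarrow>
     (\<forall>p. sentence p \<and> preserved_by_homs C p \<longrightarrow>
        (\<exists>q. sentence q \<and> existential_positive q \<and> equivalent_on C p q))"

end

theory Submission
  imports Defs
begin

text \<open>
  Call a vertex \<open>x\<close> a wheel centre if it has a neighbour and each neighbour of \<open>x\<close> shares at least
  two further neighbours with \<open>x\<close>. Having a wheel centre is first-order expressible. In a subgraph
  of an odd wheel it forces the subgraph to be not 3-colourable (it contains the full wheel, or
  a \<open>K\<^sub>4\<close>), while every proper subgraph of an odd wheel is 3-colourable. Hence on the class the
  sentence says that the graph is not 3-colourable, which homomorphisms preserve. An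
  existential-positive sentence true in a wheel with a long rim is witnessed by few vertices, so it survives the
  deletion of some rim vertex, which makes the graph 3-colourable.
\<close>

section \<open>Three-colourability and the wheel-centre sentence, both stated for bare arc
  sets\<close>

definition tricolourable :: "('a \<times> 'a) set \<Rightarrow> bool" where
  "tricolourable E \<longleftrightarrow> (\<exists>c :: 'a \<Rightarrow> nat. (\<forall>v. c v < 3) \<and> (\<forall>u v. (u, v) \<in> E \<longrightarrow> c u \<noteq> c v))"

text \<open>In a loopless symmetric \<open>E\<close> this says that the neighbourhood of
  \<open>x\<close> is nonempty and induces minimum degree at least 2; looplessness already makes
  \<open>z\<close> and \<open>w\<close> differ from \<open>y\<close>.\<close>

definition wheel_centre :: "('a \<times> 'a) set \<Rightarrow> 'a \<Rightarrow> bool" where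
  "wheel_centre E x \<longleftrightarrow> (\<exists>y. (x, y) \<in> E) \<and>
     (\<forall>y. (x, y) \<in> E \<longrightarrow>
       (\<exists>z w. z \<noteq> w \<and> (x, z) \<in> E \<and> (x, w) \<in> E \<and> (y, z) \<in> E \<and> (y, w) \<in> E))"

text \<open>Variables 0, 1, 2, 3 stand for \<open>x\<close>, \<open>y\<close>, \<open>z\<close>,
  \<open>w\<close>; the implication is written as a disjunction with a negated atom.\<close>

definition wheel_centre_fm :: fm where
  "wheel_centre_fm = Exi 0 (Cnj (Exi 1 (Adj 0 1))
     (Uni 1 (Dsj (Neg (Adj 0 1))
       (Exi 2 (Exi 3 (Cnj (Neg (Eql 2 3))
         (Cnj (Cnj (Adj 0 2) (Adj 0 3)) (Cnj (Adj 1 2) (Adj 1 3)))))))))"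

lemma sentence_wheel_centre_fm: "sentence wheel_centre_fm"
  unfolding sentence_def wheel_centre_fm_def by auto

text \<open>Every quantified vertex is an endpoint of an arc, so restricting the quantifiers to
  \<open>pverts G\<close> changes nothing.\<close>

lemma models_wheel_centre_fm:
  assumes "parcs G \<subseteq> pverts G \<times> pverts G"
  shows "models G wheel_centre_fm \<longleftrightarrow> (\<exists>x. wheel_centre (parcs G) x)"
proof -
  have inV: "u \<in> pverts G" "v \<in> pverts G" if "(u, v) \<in> parcs G" for u v
    using assms that by auto
  have unbounded: "(\<exists>y \<in> pverts G. (x, y) \<in> parcs G) \<longleftrightarrow> (\<exists>y. (x, y) \<in> parcs G)"
    "(\<exists>z \<in> pverts G. \<exists>w \<in> pverts G. z \<noteq> w \<and> (x, z) \<in> parcs G \<and> (x, w) \<in> parcs G \<and> Q z w) \<longleftrightarrow>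
     (\<exists>z w. z \<noteq> w \<and> (x, z) \<in> parcs G \<and> (x, w) \<in> parcs G \<and> Q z w)"
    "(\<forall>y \<in> pverts G. (x, y) \<in> parcs G \<longrightarrow> P y) \<longleftrightarrow> (\<forall>y. (x, y) \<in> parcs G \<longrightarrow> P y)" for x P Q
    using inV by blast+
  have "sat G s wheel_centre_fm \<longleftrightarrow> (\<exists>x \<in> pverts G. wheel_centre (parcs G) x)" for s
    unfolding wheel_centre_fm_def wheel_centre_def by (simp add: unbounded)
  moreover have "x \<in> pverts G" if "wheel_centre (parcs G) x" for x
    using that inV unfolding wheel_centre_def by blast
  ultimately have "sat G s wheel_centre_fm \<longleftrightarrow> (\<exists>x. wheel_centre (parcs G) x)" for s
    by blast
  then show ?thesis
    by (simp add: models_def)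
qed

subsection \<open>Subgraphs of odd wheels\<close>

lemma wheel_arc_iff:
  "(u, v) \<in> parcs (wheel m) \<longleftrightarrow>
     (u < m \<and> v < m \<and> (v = Suc u mod m \<or> u = Suc v mod m)) \<or> (u < m \<and> v = m) \<or> (u = m \<and> v < m)"
  unfolding wheel_def by auto

lemma Suc_mod_cases: "i < m \<Longrightarrow> Suc i mod m = (if Suc i = m then 0 else Suc i)" for i m :: nat
  by auto

lemma wheel_rim_neighbours:
  assumes "x < m" "(x, y) \<in> parcs (wheel m)"
  shows "y \<in> {Suc x mod m, (if x = 0 then m - 1 else x - 1), m}"
proof (cases "y < m")
  case True
  then have "y = Suc x mod m \<or> x = Suc y mod m"
    using assms by (simp add: wheel_arc_iff)
  then show ?thesis
    using assms(1) by (simp only: Suc_mod_cases[OF True]) (auto split: if_splits)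
next
  case False
  then show ?thesis
    using assms by (simp add: wheel_arc_iff)
qed

lemma wheel_loopless: "m \<ge> 2 \<Longrightarrow> (x, x) \<notin> parcs (wheel m)"
  unfolding wheel_arc_iff by (auto simp: Suc_mod_cases split: if_splits)

lemma sym_parcs_wheel: "sym (parcs (wheel m))"
  by (rule symI) (auto simp: wheel_arc_iff)

lemma parcs_wheel_subset: "parcs (wheel m) \<subseteq> pverts (wheel m) \<times> pverts (wheel m)"
  unfolding wheel_def by auto

lemma pair_graph_wheel:
  assumes "m \<ge> 2"
  shows "pair_graph (wheel m)"
proof
  show "finite (pverts (wheel m))"
    by (simp add: wheel_def)
  show "finite (parcs (wheel m))"
    by (rule finite_subset[OF parcs_wheel_subset]) (simp add: wheel_def)
  show "symmetric (with_proj (wheel m))"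
    using sym_parcs_wheel by (simp add: symmetric_def)
qed (use parcs_wheel_subset[of m] wheel_loopless[OF assms] in auto)

text \<open>The apex uses up one colour, so the other two alternate along the rim. As
  \<open>m - 1\<close> is even, the closing edge from \<open>m - 1\<close> to \<open>0\<close> joins
  equal colours.\<close>

lemma wheel_not_tricolourable:
  assumes "odd m" "m \<ge> 3"
  shows "\<not> tricolourable (parcs (wheel m))"
proof
  assume "tricolourable (parcs (wheel m))"
  then obtain c :: "nat \<Rightarrow> nat" where lt: "\<And>v. c v < 3"
    and c: "\<And>u v. (u, v) \<in> parcs (wheel m) \<Longrightarrow> c u \<noteq> c v"
    unfolding tricolourable_def by blast
  have apex: "c i \<noteq> c m" if "i < m" for i
    using c[of i m] that by (simp add: wheel_arc_iff)
  have rim: "c i \<noteq> c (Suc i)" if "Suc i < m" for i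
    using c[of i "Suc i"] that by (simp add: wheel_arc_iff)
  have alternate: "c i = c (if even i then 0 else 1)" if "i < m" for i
    using that
  proof (induction i)
    case (Suc i)
    have "c i \<noteq> c m" "c (Suc i) \<noteq> c m" "c 0 \<noteq> c m" "c 1 \<noteq> c m" "c i \<noteq> c (Suc i)" "c 0 \<noteq> c 1"
      using apex rim[of i] rim[of 0] Suc.prems assms(2) by auto
    moreover have "c i = c (if even i then 0 else 1)"
      using Suc by simp
    ultimately show ?case
      using lt[of i] lt[of "Suc i"] lt[of 0] lt[of 1] lt[of m] by (auto split: if_splits)
  qed simp
  have "c (m - 1) = c 0"
    using alternate[of "m - 1"] assms by simp
  moreover have "c (m - 1) \<noteq> c 0"
    by (rule c) (use assms in \<open>auto simp: wheel_arc_iff\<close>)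
  ultimately show False by simp
qed

text \<open>Without some rim edge the rim splits open and needs only two colours; without some
  spoke, its rim end may share the colour of the apex and so break the odd cycle.\<close>

lemma proper_wheel_subgraph_tricolourable:
  assumes m: "odd m" "m \<ge> 3" and E: "E \<subseteq> parcs (wheel m)" "sym E" "E \<noteq> parcs (wheel m)"
  shows "tricolourable E"
proof -
  obtain a b where "(a, b) \<in> parcs (wheel m)" "(a, b) \<notin> E"
    using E by auto
  then have missing: "(a, b) \<notin> E" "(b, a) \<notin> E" "(a, b) \<in> parcs (wheel m)"
    using E(2) by (auto dest: symD)
  consider i where "i < m" "(i, m) \<notin> E" "(m, i) \<notin> E"
    | i where "i < m" "(i, Suc i mod m) \<notin> E" "(Suc i mod m, i) \<notin> E"
    using missing unfolding wheel_arc_iff by metis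
  then obtain i where i: "i < m"
    and cases: "(i, m) \<notin> E \<and> (m, i) \<notin> E \<or> (i, Suc i mod m) \<notin> E \<and> (Suc i mod m, i) \<notin> E"
    by metis
  txt \<open>Alternate along the rim from \<open>i + 1\<close> round to \<open>i\<close>: only the edge \<open>{i, i + 1}\<close> is then violated.\<close>
  define d where "d j = (of_bool (odd (if j > i then i + j + 1 else i + j)) :: nat)" for j
  have d: "d j \<noteq> d (Suc j mod m)" if "j < m" "j \<noteq> i" for j
  proof (cases "Suc j = m")
    case True
    \<comment> \<open>Across the wrap the number whose parity is taken changes from
      \<open>i + m\<close> to \<open>i\<close>, an odd difference.\<close>
    then have "even j" "j > i"
      using m(1) that i by auto
    then show ?thesis
      using True by (simp add: d_def)
  next
    case False
    then show ?thesis
      using that by (auto simp: d_def Suc_mod_cases)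
  qed
  have d2: "d j < 2" for j
    by (simp add: d_def)
  \<comment> \<open>Colour 2 belongs to the apex. Giving it to \<open>i\<close> when the spoke is
    absent repairs the edge from \<open>i\<close> to its successor; otherwise that rim edge is the
    missing one.\<close>
  define c where "c j = (if j = m then 2 else if j = i \<and> (i, m) \<notin> E then 2 else d j)" for j
  have c3: "c j < 3" for j
    using d2[of j] by (auto simp: c_def)
  have rim: "c j \<noteq> c (Suc j mod m)" if "j < m" "(j, Suc j mod m) \<in> E" for j
  proof -
    have "Suc j mod m < m" "Suc j mod m \<noteq> j"
      using that(1) m by (auto simp: Suc_mod_cases)
    then show ?thesis
      using that d[of j] d2[of j] d2[of "Suc j mod m"] cases
      by (auto simp: c_def)
  qed
  have "c u \<noteq> c v" if uv: "(u, v) \<in> E" for u v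
  proof -
    have vu: "(v, u) \<in> E"
      using uv E(2) by (auto dest: symD)
    have "(u, v) \<in> parcs (wheel m)"
      using uv E(1) by auto
    then consider "u < m" "v = Suc u mod m" | "v < m" "u = Suc v mod m"
      | "u < m" "v = m" | "u = m" "v < m"
      unfolding wheel_arc_iff by blast
    then show ?thesis
    proof cases
      case 1
      then show ?thesis using rim[of u] uv by simp
    next
      case 2
      then show ?thesis using rim[of v] vu by simp
    next
      case 3
      then show ?thesis using uv d2[of u] by (auto simp: c_def)
    next
      case 4
      then show ?thesis using vu d2[of v] by (auto simp: c_def)
    qed
  qed
  with c3 show ?thesis
    unfolding tricolourable_def by blast
qed

text \<open>A rim vertex shares with the apex its two rim neighbours, which are distinct because
  \<open>m \<ge> 3\<close>.\<close>

lemma wheel_centre_apex: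
  assumes "m \<ge> 3"
  shows "wheel_centre (parcs (wheel m)) m"
  unfolding wheel_centre_def
proof (intro conjI allI impI)
  show "\<exists>y. (m, y) \<in> parcs (wheel m)"
    using assms by (intro exI[of _ 0]) (auto simp: wheel_arc_iff)
next
  fix y assume "(m, y) \<in> parcs (wheel m)"
  then have y: "y < m"
    by (auto simp: wheel_arc_iff)
  let ?z = "Suc y mod m" and ?w = "if y = 0 then m - 1 else y - 1"
  have "?z \<noteq> ?w \<and> (m, ?z) \<in> parcs (wheel m) \<and> (m, ?w) \<in> parcs (wheel m)
      \<and> (y, ?z) \<in> parcs (wheel m) \<and> (y, ?w) \<in> parcs (wheel m)"
    using y assms by (auto simp: wheel_arc_iff Suc_mod_cases)
  then show "\<exists>z w. z \<noteq> w \<and> (m, z) \<in> parcs (wheel m) \<and> (m, w) \<in> parcs (wheel m)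
      \<and> (y, z) \<in> parcs (wheel m) \<and> (y, w) \<in> parcs (wheel m)"
    by blast
qed

text \<open>A rim vertex has only two neighbours besides the apex. If its spoke is in
  \<open>E\<close>, the centre condition forces both rim edges at it and the spokes at their other
  ends, and this propagates round the rim.\<close>

lemma wheel_centre_apex_imp_full:
  assumes m: "m \<ge> 3" and E: "E \<subseteq> parcs (wheel m)" "sym E" and centre: "wheel_centre E m"
  shows "E = parcs (wheel m)"
proof -
  have step: "(m, Suc i mod m) \<in> E \<and> (i, Suc i mod m) \<in> E" if i: "(m, i) \<in> E" for i
  proof -
    have im: "i < m"
      using i E(1) by (auto simp: wheel_arc_iff)
    obtain z w where zw: "z \<noteq> w" "(m, z) \<in> E" "(m, w) \<in> E" "(i, z) \<in> E" "(i, w) \<in> E"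
      using centre i unfolding wheel_centre_def by blast
    have "z \<noteq> m" "w \<noteq> m"
      using zw E(1) wheel_loopless[of m m] m by auto
    moreover have "z \<in> {Suc i mod m, (if i = 0 then m - 1 else i - 1), m}"
      "w \<in> {Suc i mod m, (if i = 0 then m - 1 else i - 1), m}"
      using wheel_rim_neighbours[OF im] zw E(1) by blast+
    \<comment> \<open>Two distinct elements among only two candidates exhaust them.\<close>
    ultimately have "Suc i mod m \<in> {z, w}"
      using zw(1) by blast
    then show ?thesis
      using zw by auto
  qed
  obtain y where y: "(m, y) \<in> E"
    using centre unfolding wheel_centre_def by blast
  have ym: "y < m"
    using y E(1) by (auto simp: wheel_arc_iff)
  have walk: "(m, (y + k) mod m) \<in> E" for k
  proof (induction k)
    case 0
    then show ?case using y ym by simp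
  next
    case (Suc k)
    then show ?case using step[OF Suc] by (simp add: mod_Suc_eq)
  qed
  have spoke: "(m, i) \<in> E" if "i < m" for i
  proof -
    have "(y + (m - y + i)) mod m = i"
      using that ym by simp
    then show ?thesis
      using walk[of "m - y + i"] by simp
  qed
  have "(u, v) \<in> E" if uv: "(u, v) \<in> parcs (wheel m)" for u v
  proof -
    consider "u < m" "v = Suc u mod m" | "v < m" "u = Suc v mod m" | "u < m" "v = m" | "u = m" "v < m"
      using uv unfolding wheel_arc_iff by blast
    then have "(u, v) \<in> E \<or> (v, u) \<in> E"
      by cases (use spoke step in auto)
    then show ?thesis
      using E(2) by (auto dest: symD)
  qed
  then show ?thesis
    using E(1) by auto
qed

lemma clique4_not_tricolourable:
  assumes "(a, b) \<in> E" "(a, c) \<in> E" "(a, d) \<in> E" "(b, c) \<in> E" "(b, d) \<in> E" "(c, d) \<in> E"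
  shows "\<not> tricolourable E"
proof
  assume "tricolourable E"
  then obtain f :: "_ \<Rightarrow> nat" where lt: "\<And>v. f v < 3" and f: "\<And>u v. (u, v) \<in> E \<Longrightarrow> f u \<noteq> f v"
    unfolding tricolourable_def by blast
  show False
    using assms[THEN f] lt[of a] lt[of b] lt[of c] lt[of d] by linarith
qed

text \<open>The only possible neighbours are the two rim neighbours and the apex. Each one present
  needs two others, so all three are present and pairwise adjacent, giving a \<open>K_4\<close> with
  \<open>x\<close>. This does occur, in \<open>wheel 3\<close>.\<close>

lemma wheel_centre_rim_imp_not_tricolourable:
  assumes m: "m \<ge> 3" and E: "E \<subseteq> parcs (wheel m)" and x: "x < m" and centre: "wheel_centre E x"
  shows "\<not> tricolourable E"
proof -
  define p where "p = (if x = 0 then m - 1 else x - 1)"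
  define s where "s = Suc x mod m"
  have nbr: "y \<in> {s, p, m}" if "(x, y) \<in> E" for y
    using wheel_rim_neighbours[OF x] that E unfolding p_def s_def by blast
  have loopless: "(v, v) \<notin> E" for v
    using wheel_loopless[of m v] m E by auto
  have two: "\<exists>z w. z \<noteq> w \<and> z \<noteq> y \<and> w \<noteq> y \<and> (x, z) \<in> E \<and> (x, w) \<in> E \<and> (y, z) \<in> E \<and> (y, w) \<in> E"
    if "(x, y) \<in> E" for y
    using centre that loopless unfolding wheel_centre_def by metis
  obtain y where y: "(x, y) \<in> E"
    using centre unfolding wheel_centre_def by blast
  have all: "(x, s) \<in> E" "(x, p) \<in> E" "(x, m) \<in> E"
    using two[OF y] nbr y by blast+
  have "(s, p) \<in> E" "(s, m) \<in> E" "(p, m) \<in> E"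
    using two[OF all(1)] two[OF all(2)] nbr by blast+
  with all show ?thesis
    by (rule clique4_not_tricolourable)
qed

text \<open>Base case of the closure invariant: a centre at the apex forces the full wheel and one
  on the rim forces a \<open>K_4\<close>, while an uncolourable subgraph must be the full
  wheel.\<close>

lemma odd_wheel_subgraph_iff:
  assumes "odd m" "m \<ge> 3" "E \<subseteq> parcs (wheel m)" "sym E"
  shows "(\<exists>x. wheel_centre E x) \<longleftrightarrow> \<not> tricolourable E"
proof
  assume "\<exists>x. wheel_centre E x"
  then obtain x where x: "wheel_centre E x" ..
  then have "x \<le> m"
    using assms(3) unfolding wheel_centre_def by (force simp: wheel_arc_iff)
  then consider "x = m" | "x < m"
    by linarith
  then show "\<not> tricolourable E"
  proof cases
    case 1
    then show ?thesis
      using wheel_centre_apex_imp_full wheel_not_tricolourable assms x by metis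
  next
    case 2
    then show ?thesis
      using wheel_centre_rim_imp_not_tricolourable assms x by blast
  qed
next
  assume "\<not> tricolourable E"
  then have "E = parcs (wheel m)"
    using proper_wheel_subgraph_tricolourable assms by blast
  then show "\<exists>x. wheel_centre E x"
    using wheel_centre_apex assms(2) by blast
qed

subsection \<open>The closure of the odd wheels\<close>

lemma tricolourable_hom:
  assumes "tricolourable E'" "\<And>u v. (u, v) \<in> E \<Longrightarrow> (f u, f v) \<in> E'"
  shows "tricolourable E"
proof -
  obtain c :: "_ \<Rightarrow> nat" where "\<And>v. c v < 3" "\<And>u v. (u, v) \<in> E' \<Longrightarrow> c u \<noteq> c v"
    using assms(1) unfolding tricolourable_def by blast
  then show ?thesis
    using assms(2) unfolding tricolourable_def by (intro exI[of _ "c \<circ> f"]) auto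
qed

text \<open>Injectivity keeps \<open>z\<close> and \<open>w\<close> distinct and lifts every
  neighbour of \<open>f x\<close> to a neighbour of \<open>x\<close>.\<close>

lemma wheel_centre_iso:
  assumes "wheel_centre E x" "inj_on f V" "E \<subseteq> V \<times> V"
  shows "wheel_centre (map_prod f f ` E) (f x)"
proof -
  have inj: "u = v" if "f u = f v" "u \<in> V" "v \<in> V" for u v
    using assms(2) that by (rule inj_onD)
  have E: "u \<in> V" "v \<in> V" if "(u, v) \<in> E" for u v
    using assms(3) that by auto
  have xV: "x \<in> V"
    using assms(1) E unfolding wheel_centre_def by blast
  have img: "(f u, f v) \<in> map_prod f f ` E" if "(u, v) \<in> E" for u v
    using that by force
  show ?thesis
    unfolding wheel_centre_def
  proof (intro conjI allI impI)
    show "\<exists>y. (f x, y) \<in> map_prod f f ` E"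
      using assms(1) img unfolding wheel_centre_def by blast
  next
    fix y assume "(f x, y) \<in> map_prod f f ` E"
    then obtain u v where uv: "(u, v) \<in> E" "f x = f u" "y = f v"
      by auto
    then have "(x, v) \<in> E"
      using inj[OF uv(2) xV E(1)[OF uv(1)]] by simp
    then obtain z w where zw: "z \<noteq> w" "(x, z) \<in> E" "(x, w) \<in> E" "(v, z) \<in> E" "(v, w) \<in> E"
      using assms(1) unfolding wheel_centre_def by blast
    then have "f z \<noteq> f w"
      using inj E by metis
    then show "\<exists>z w. z \<noteq> w \<and> (f x, z) \<in> map_prod f f ` E \<and> (f x, w) \<in> map_prod f f ` E
        \<and> (y, z) \<in> map_prod f f ` E \<and> (y, w) \<in> map_prod f f ` E"
      using img zw uv(3) by blast
  qed
qed

text \<open>Being a centre depends only on the arcs leaving \<open>x\<close> and its neighbours;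
  this localises centres to one side of a disjoint union.\<close>

lemma wheel_centre_cong:
  assumes x: "x \<in> U" and eq: "\<And>u v. u \<in> U \<Longrightarrow> (u, v) \<in> E \<longleftrightarrow> (u, v) \<in> D"
    and closed: "\<And>u v. (u, v) \<in> D \<Longrightarrow> v \<in> U"
  shows "wheel_centre E x \<longleftrightarrow> wheel_centre D x"
proof -
  have "(x, y) \<in> E \<longleftrightarrow> (x, y) \<in> D" for y
    using x by (rule eq)
  moreover have "(y, z) \<in> E \<longleftrightarrow> (y, z) \<in> D" if "(x, y) \<in> D" for y z
    using closed[OF that] by (rule eq)
  ultimately show ?thesis
    unfolding wheel_centre_def by (simp cong: conj_cong imp_cong)
qed

text \<open>
  Subgraphs enter only through their arcs: isolated vertices affect neither colourability nor
  wheel centres. Quantifying over all of them makes the property an invariant of the closure.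
\<close>

definition hereditary_centre_iff :: "'a pair_pre_digraph \<Rightarrow> bool" where
  "hereditary_centre_iff G \<longleftrightarrow> parcs G \<subseteq> pverts G \<times> pverts G \<and> sym (parcs G) \<and>
     (\<forall>E \<subseteq> parcs G. sym E \<longrightarrow> ((\<exists>x. wheel_centre E x) \<longleftrightarrow> \<not> tricolourable E))"

text \<open>An arc set \<open>E\<close> of \<open>H\<close> is pulled back to an isomorphic arc set
  \<open>D\<close> of \<open>G\<close>, and both sides of the equivalence are transported.\<close>

lemma hereditary_centre_iff_iso:
  assumes G: "hereditary_centre_iff G" and iso: "digraph_iso (with_proj G) (with_proj H)"
  shows "hereditary_centre_iff H"
proof -
  obtain hom where hom: "pre_digraph.digraph_isomorphism (with_proj G) hom"
    and H: "with_proj H = app_iso hom (with_proj G)"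
    using iso unfolding digraph_iso_def by blast
  define f where "f = iso_verts hom"
  have GV: "parcs G \<subseteq> pverts G \<times> pverts G"
    using G unfolding hereditary_centre_iff_def by blast
  have inj: "inj_on f (pverts G)"
    using hom unfolding pre_digraph.digraph_isomorphism_def f_def by simp
  have vH: "pverts H = f ` pverts G"
    using arg_cong[OF H, of verts] by (simp add: app_iso_def f_def)
  have aH: "parcs H = iso_arcs hom ` parcs G"
    using arg_cong[OF H, of arcs] by (simp add: app_iso_def)
  \<comment> \<open>Both graphs use the projections as tail and head, so the arc map of the
    isomorphism must be \<open>f\<close> on both components.\<close>
  have "fst = iso_tail hom" "snd = iso_head hom"
    using arg_cong[OF H, of tail] arg_cong[OF H, of head] by (simp_all add: app_iso_def)
  then have arc: "iso_arcs hom a = map_prod f f a" if "a \<in> parcs G" for a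
    using that hom unfolding pre_digraph.digraph_isomorphism_def f_def
    by (simp add: prod_eq_iff)
  have pH: "parcs H = map_prod f f ` parcs G"
    unfolding aH by (rule image_cong) (auto simp: arc)
  have HV: "parcs H \<subseteq> pverts H \<times> pverts H"
    using GV unfolding pH vH by auto
  moreover have "sym (parcs H)"
    using G unfolding hereditary_centre_iff_def pH by (auto simp: sym_def)
  moreover have "(\<exists>x. wheel_centre E x) \<longleftrightarrow> \<not> tricolourable E" if E: "E \<subseteq> parcs H" "sym E" for E
  proof -
    define D where "D = {(u, v) \<in> parcs G. (f u, f v) \<in> E}"
    define g where "g = inv_into (pverts G) f"
    have D: "D \<subseteq> parcs G"
      unfolding D_def by auto
    have ED: "E = map_prod f f ` D"
      using E(1) unfolding D_def pH by force
    have gf: "g (f v) = v" if "v \<in> pverts G" for v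
      using inj that unfolding g_def by simp
    have "map_prod g g (map_prod f f a) = a" if "a \<in> D" for a
      using that D GV gf by (cases a) auto
    then have DE: "D = map_prod g g ` E"
      unfolding ED by (simp add: image_image)
    have "sym D"
      using E(2) unfolding DE by (auto simp: sym_def)
    then have iff: "(\<exists>x. wheel_centre D x) \<longleftrightarrow> \<not> tricolourable D"
      using G D unfolding hereditary_centre_iff_def by blast
    have "(f u, f v) \<in> E" if "(u, v) \<in> D" for u v
      using that unfolding D_def by simp
    moreover have "(g u, g v) \<in> D" if "(u, v) \<in> E" for u v
      using that unfolding DE by force
    ultimately have "tricolourable D \<longleftrightarrow> tricolourable E"
      using tricolourable_hom by metis
    moreover have "(\<exists>x. wheel_centre D x) \<longleftrightarrow> (\<exists>x. wheel_centre E x)"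
    proof
      assume "\<exists>x. wheel_centre D x"
      then show "\<exists>x. wheel_centre E x"
        using wheel_centre_iso[OF _ inj] D GV unfolding ED by blast
    next
      have "inj_on g (pverts H)"
        unfolding g_def vH by (rule inj_on_inv_into) simp
      moreover assume "\<exists>x. wheel_centre E x"
      ultimately show "\<exists>x. wheel_centre D x"
        using wheel_centre_iso[of E _ g "pverts H"] E HV unfolding DE by blast
    qed
    ultimately show ?thesis
      using iff by simp
  qed
  ultimately show ?thesis
    unfolding hereditary_centre_iff_def by blast
qed

text \<open>No arc crosses between the sides. Hence \<open>E\<close> has a centre iff one of its two
  parts has one, and it is 3-colourable iff both parts are.\<close>

lemma hereditary_centre_iff_union:
  assumes G: "hereditary_centre_iff G" and H: "hereditary_centre_iff H"
    and disj: "pverts G \<inter> pverts H = {}"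
  shows "hereditary_centre_iff (graph_union G H)"
proof -
  have GV: "parcs G \<subseteq> pverts G \<times> pverts G" and HV: "parcs H \<subseteq> pverts H \<times> pverts H"
    using G H unfolding hereditary_centre_iff_def by blast+
  have "(\<exists>x. wheel_centre E x) \<longleftrightarrow> \<not> tricolourable E"
    if E: "E \<subseteq> parcs G \<union> parcs H" "sym E" for E
  proof -
    define D where "D = E \<inter> pverts G \<times> pverts G"
    define F where "F = E \<inter> pverts H \<times> pverts H"
    have EDF: "E = D \<union> F"
      using E(1) GV HV unfolding D_def F_def by auto
    have DG: "D \<subseteq> parcs G" and FH: "F \<subseteq> parcs H"
      using E(1) GV HV disj unfolding D_def F_def by blast+
    have "sym D" "sym F"
      using E(2) unfolding D_def F_def sym_def by auto
    then have iff: "(\<exists>x. wheel_centre D x) \<longleftrightarrow> \<not> tricolourable D"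
      "(\<exists>x. wheel_centre F x) \<longleftrightarrow> \<not> tricolourable F"
      using G H DG FH unfolding hereditary_centre_iff_def by blast+
    have inD: "(u, v) \<in> E \<longleftrightarrow> (u, v) \<in> D" if "u \<in> pverts G" for u v
      using that disj E(1) GV HV unfolding D_def by auto
    have inF: "(u, v) \<in> E \<longleftrightarrow> (u, v) \<in> F" if "u \<notin> pverts G" for u v
      using that E(1) GV HV unfolding F_def by auto
    have DV: "u \<in> pverts G" "v \<in> pverts G" if "(u, v) \<in> D" for u v
      using that unfolding D_def by auto
    have FV: "u \<notin> pverts G" "v \<notin> pverts G" if "(u, v) \<in> F" for u v
      using that disj unfolding F_def by auto
    have "wheel_centre E x \<longleftrightarrow> wheel_centre D x" if "x \<in> pverts G" for x
      using that by (rule wheel_centre_cong) (auto simp: inD dest: DV)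
    moreover have "wheel_centre E x \<longleftrightarrow> wheel_centre F x" if "x \<notin> pverts G" for x
      \<comment> \<open>The complement of \<open>pverts G\<close> replaces \<open>pverts H\<close>
        so that the two cases cover every element of the type.\<close>
      by (rule wheel_centre_cong[of x "- pverts G"]) (use that in \<open>auto simp: inF dest: FV\<close>)
    moreover have "wheel_centre D x \<Longrightarrow> x \<in> pverts G" "wheel_centre F x \<Longrightarrow> x \<notin> pverts G" for x
      using DV FV unfolding wheel_centre_def by blast+
    ultimately have "(\<exists>x. wheel_centre E x) \<longleftrightarrow> (\<exists>x. wheel_centre D x) \<or> (\<exists>x. wheel_centre F x)"
      by metis
    moreover have "tricolourable E \<longleftrightarrow> tricolourable D \<and> tricolourable F"
    proof
      assume "tricolourable E"
      then show "tricolourable D \<and> tricolourable F"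
        unfolding tricolourable_def EDF by blast
    next
      assume "tricolourable D \<and> tricolourable F"
      then obtain c d :: "_ \<Rightarrow> nat" where "\<forall>v. c v < 3" "\<forall>u v. (u, v) \<in> D \<longrightarrow> c u \<noteq> c v"
        "\<forall>v. d v < 3" "\<forall>u v. (u, v) \<in> F \<longrightarrow> d u \<noteq> d v"
        unfolding tricolourable_def by blast
      then show "tricolourable E"
        unfolding tricolourable_def EDF using DV FV
        by (intro exI[of _ "\<lambda>v. if v \<in> pverts G then c v else d v"]) auto
    qed
    ultimately show ?thesis
      using iff by blast
  qed
  moreover have "sym (parcs G \<union> parcs H)"
    using G H unfolding hereditary_centre_iff_def by (simp add: sym_Un)
  ultimately show ?thesis
    using GV HV unfolding hereditary_centre_iff_def graph_union_def by auto
qed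

text \<open>Rule induction on the closure; the subgraph case is transitivity of inclusion between
  arc sets.\<close>

lemma odd_wheel_class_hereditary_centre_iff:
  assumes "G \<in> odd_wheel_class"
  shows "hereditary_centre_iff G"
  using assms unfolding odd_wheel_class_def
proof (induction rule: subgraph_union_closure.induct)
  case (base G)
  then obtain n where "G = wheel (2 * n + 1)" "n \<ge> 1"
    by blast
  then show ?case
    using odd_wheel_subgraph_iff[of "2 * n + 1"] parcs_wheel_subset sym_parcs_wheel
    unfolding hereditary_centre_iff_def by simp
next
  case (iso G H)
  then show ?case
    using hereditary_centre_iff_iso by blast
next
  case (subgraph G H)
  interpret H: pair_graph H
    by fact
  have "parcs H \<subseteq> parcs G"
    using subgraph.hyps by (auto simp: subgraph_def)
  moreover have "parcs H \<subseteq> pverts H \<times> pverts H"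
    using H.in_arcsD1 H.in_arcsD2 by auto
  moreover have "sym (parcs H)"
    using H.pair_sym_arcs by (simp add: symmetric_def)
  ultimately show ?case
    using subgraph.IH unfolding hereditary_centre_iff_def by blast
next
  case (disjoint_union G H)
  then show ?case
    using hereditary_centre_iff_union by blast
qed

section \<open>Preservation of the sentence under homomorphisms\<close>

lemma odd_wheel_class_models_iff:
  assumes "G \<in> odd_wheel_class"
  shows "models G wheel_centre_fm \<longleftrightarrow> \<not> tricolourable (parcs G)"
proof -
  have "hereditary_centre_iff G"
    using assms by (rule odd_wheel_class_hereditary_centre_iff)
  then show ?thesis
    using models_wheel_centre_fm unfolding hereditary_centre_iff_def by blast
qed

text \<open>A 3-colouring of \<open>B\<close> would pull back along the homomorphism to one of
  \<open>A\<close>.\<close>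

lemma preserved_wheel_centre_fm: "preserved_by_homs odd_wheel_class wheel_centre_fm"
  unfolding preserved_by_homs_def
proof (intro ballI impI)
  fix A B
  assume AB: "A \<in> odd_wheel_class" "B \<in> odd_wheel_class"
    and "\<exists>f. graph_hom A B f" "models A wheel_centre_fm"
  moreover from this obtain f where "\<And>u v. (u, v) \<in> parcs A \<Longrightarrow> (f u, f v) \<in> parcs B"
    unfolding graph_hom_def by blast
  ultimately show "models B wheel_centre_fm"
    using odd_wheel_class_models_iff tricolourable_hom by metis
qed

subsection \<open>Existential-positive sentences\<close>

text \<open>\<open>S\<close> collects one chosen witness for each existential quantifier met. Values
  of free variables are kept apart from \<open>S\<close> for the induction; for a sentence they
  vanish. \<open>H\<close> need not be a subgraph of \<open>G\<close>, since positive formulas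
  survive added vertices and arcs.\<close>

lemma existential_positive_witnesses:
  assumes "existential_positive q" "sat G s q"
  shows "\<exists>S. finite S \<and> card S \<le> size q \<and> S \<subseteq> pverts G \<and>
    (\<forall>H. S \<subseteq> pverts H \<longrightarrow>
      parcs G \<inter> (S \<union> s ` free_vars q) \<times> (S \<union> s ` free_vars q) \<subseteq> parcs H \<longrightarrow> sat H s q)"
    (is "\<exists>S. ?P q s S")
  using assms
proof (induction q arbitrary: s)
  case (Cnj p q)
  then obtain S T where S: "?P p s S" and T: "?P q s T"
    by fastforce
  have "card (S \<union> T) \<le> size (Cnj p q)"
    using S T card_Un_le[of S T] by simp
  moreover have "sat H s (Cnj p q)"
    if "S \<union> T \<subseteq> pverts H" "parcs G \<inter> (S \<union> T \<union> s ` free_vars (Cnj p q)) \<times>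
      (S \<union> T \<union> s ` free_vars (Cnj p q)) \<subseteq> parcs H" for H
  proof -
    have "parcs G \<inter> (S \<union> s ` free_vars p) \<times> (S \<union> s ` free_vars p) \<subseteq> parcs H"
      "parcs G \<inter> (T \<union> s ` free_vars q) \<times> (T \<union> s ` free_vars q) \<subseteq> parcs H"
      using that(2) by (auto simp: image_Un)
    then show ?thesis
      using S T that(1) by simp
  qed
  ultimately have "?P (Cnj p q) s (S \<union> T)"
    using S T by simp
  then show ?case ..
next
  case (Dsj p q)
  then consider S where "?P p s S" "existential_positive p" | S where "?P q s S"
    by fastforce
  then show ?case
  proof cases
    case (1 S)
    then have "?P (Dsj p q) s S"
      by (auto simp: image_Un subset_iff)
    then show ?thesis ..
  next
    case (2 S)
    then have "?P (Dsj p q) s S"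
      by (auto simp: image_Un subset_iff)
    then show ?thesis ..
  qed
next
  case (Exi x p)
  then obtain v where v: "v \<in> pverts G" "sat G (s(x := v)) p"
    by auto
  then obtain S where S: "?P p (s(x := v)) S"
    using Exi.IH[OF _ v(2)] Exi.prems(1) by auto
  have "card (insert v S) \<le> size (Exi x p)"
    using S card_insert_le_m1[of "size (Exi x p)" S v] by simp
  moreover have "sat H s (Exi x p)"
    if "insert v S \<subseteq> pverts H" "parcs G \<inter> (insert v S \<union> s ` free_vars (Exi x p)) \<times>
      (insert v S \<union> s ` free_vars (Exi x p)) \<subseteq> parcs H" for H
  proof -
    \<comment> \<open>The witness \<open>v\<close>, a value of the assignment inside the quantifier,
      becomes a member of the witness set outside it.\<close>
    have "S \<union> (s(x := v)) ` free_vars p \<subseteq> insert v S \<union> s ` free_vars (Exi x p)"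
      by auto
    then have "parcs G \<inter> (S \<union> (s(x := v)) ` free_vars p) \<times> (S \<union> (s(x := v)) ` free_vars p)
        \<subseteq> parcs H"
      using that(2) by blast
    then have "sat H (s(x := v)) p"
      using S that(1) by blast
    then show ?thesis
      using that(1) by auto
  qed
  ultimately have "?P (Exi x p) s (insert v S)"
    using S v(1) by simp
  then show ?case ..
\<comment> \<open>Constants and atoms need no witnesses; \<open>Neg\<close> and \<open>Uni\<close>
  contradict the assumption.\<close>
qed (auto intro!: exI[of _ "{}"])

section \<open>Inexpressibility by existential-positive sentences\<close>

lemma wheel_in_odd_wheel_class:
  assumes "n \<ge> 1"
  shows "wheel (2 * n + 1) \<in> odd_wheel_class"
  using assms unfolding odd_wheel_class_def by (intro subgraph_union_closure.base) blast

lemma not_equivalent_existential_positive: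
  assumes q: "sentence q" "existential_positive q"
  shows "\<not> equivalent_on odd_wheel_class wheel_centre_fm q"
proof
  assume equiv: "equivalent_on odd_wheel_class wheel_centre_fm q"
  \<comment> \<open>This makes the rim longer than \<open>size q\<close>, so the witnesses must miss
    some rim vertex.\<close>
  define n where "n = size q + 1"
  define m where "m = 2 * n + 1"
  have m: "odd m" "m \<ge> 3" and W: "wheel m \<in> odd_wheel_class"
    using wheel_in_odd_wheel_class[of n] unfolding m_def n_def by auto
  have "models (wheel m) wheel_centre_fm"
    using odd_wheel_class_models_iff[OF W] wheel_not_tricolourable[OF m] by simp
  then have "sat (wheel m) id q"
    using equiv W q(1) unfolding equivalent_on_def by (metis models_iff_sat)
  then obtain S where S: "finite S" "card S \<le> size q" "S \<subseteq> pverts (wheel m)"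
    and sat: "\<And>H. S \<subseteq> pverts H \<Longrightarrow> parcs (wheel m) \<inter> S \<times> S \<subseteq> parcs H \<Longrightarrow> sat H id q"
    using existential_positive_witnesses[OF q(2)] q(1) unfolding sentence_def
    by (metis Un_empty_right image_empty)
  have "\<not> {..<m} \<subseteq> S"
    using S card_mono[of S "{..<m}"] unfolding m_def n_def by auto
  then obtain i where i: "i < m" "i \<notin> S"
    by auto
  define V where "V = pverts (wheel m) - {i}"
  \<comment> \<open>Deleting only \<open>i\<close>, which lies outside \<open>S\<close>, retains
    every arc between witnesses, so \<open>q\<close> stays true in \<open>H\<close>.\<close>
  define H where "H = \<lparr>pverts = V, parcs = parcs (wheel m) \<inter> V \<times> V\<rparr>"
  interpret W: pair_graph "wheel m"
    using m by (intro pair_graph_wheel) simp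
  have H: "pair_graph H"
  proof
    show "symmetric (with_proj H)"
      using sym_parcs_wheel[of m] by (auto simp: H_def symmetric_def sym_def)
  qed (use W.no_loops in \<open>auto simp: H_def V_def\<close>)
  then interpret H: pair_graph H .
  have "subgraph (with_proj H) (with_proj (wheel m))"
    using W.wf_digraph_axioms H.wf_digraph_axioms unfolding subgraph_def compatible_def
    by (auto simp: H_def V_def)
  then have HC: "H \<in> odd_wheel_class"
    using W H unfolding odd_wheel_class_def by (blast intro: subgraph_union_closure.subgraph)
  have "sat H id q"
    by (rule sat) (use S i in \<open>auto simp: H_def V_def\<close>)
  then have "models H wheel_centre_fm"
    using equiv HC q(1) unfolding equivalent_on_def by (metis models_iff_sat)
  then have "\<not> tricolourable (parcs H)"
    using odd_wheel_class_models_iff[OF HC] by simp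
  \<comment> \<open>The spoke at \<open>i\<close> is gone, so \<open>H\<close> is a proper subgraph
    and hence 3-colourable.\<close>
  moreover have "parcs H \<noteq> parcs (wheel m)"
  proof -
    have "(i, m) \<in> parcs (wheel m)" "(i, m) \<notin> parcs H"
      using i by (auto simp: wheel_arc_iff H_def V_def)
    then show ?thesis by blast
  qed
  ultimately show False
    using proper_wheel_subgraph_tricolourable[OF m, of "parcs H"] odd_wheel_class_hereditary_centre_iff[OF HC]
    unfolding hereditary_centre_iff_def
    by (auto simp: H_def)
qed

theorem theorem3p4:
  shows "\<not> hom_preservation_property odd_wheel_class \<and>
    (\<exists>\<phi>. sentence \<phi> \<and> preserved_by_homs odd_wheel_class \<phi> \<and>
      (\<forall>\<psi>. sentence \<psi> \<and> existential_positive \<psi> \<longrightarrow> \<not> equivalent_on odd_wheel_class \<phi> \<psi>))"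
  using sentence_wheel_centre_fm preserved_wheel_centre_fm not_equivalent_existential_positive
  unfolding hom_preservation_property_def by blast

end
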